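(* Let $\mathbb{K}[X,X^{-1}]$ be the Laurent polynomial algebra with its usual product $m$ and the coproduct $\Delta$ which is the algebra morphism with $\Delta(X)=X\otimes X$. The bilinear products $\bullet$ on $\mathbb{K}[X,X^{-1}]$ making $(\mathbb{K}[X,X^{-1}],m,\bullet,\Delta)$ a Com-PreLie bialgebra are exactly those of the following three families: 1. $\bullet=0$. 2. There exist $k_0\in\mathbb{Z}$, nonzero, and $a\in\mathbb{K}$, nonzero, such that for all $k,l\in\mathbb{Z}$, $X^k\bullet X^l=a\,\delta_{l,k_0}\,k\,(X^k-X^{k+l})$. 3. There exist $\alpha,\beta\in\mathbb{K}\setminus\{0\}$ such that $n\alpha-(n-1)\beta\neq0$ for any $n\in\mathbb{Z}$, $n\neq-1$, and $N\geq1$, such that for all $k,l\in\mathbb{Z}$, \[X^k\bullet X^l=\begin{cases}\dfrac{\alpha\beta}{\left(\frac lN-1\right)\alpha-\left(\frac lN-2\right)\beta}\,k\,(X^k-X^{k+l})&\text{if }N\mid l,\\ 0&\text{otherwise,}\end{cases}\] with the convention that $X^k\bullet1=0$ (also when the denominator vanishes for $l=0$, i.e. when $-\alpha+2\beta=0$).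
   Context: $\mathbb{K}$ is a field of characteristic zero; $\delta$ is the Kronecker symbol. A Com-PreLie algebra is a vector space $A$ with bilinear products $\cdot,\bullet$ such that $\cdot$ is commutative and associative and, for all $a,b,c\in A$, $(a\bullet b)\bullet c-a\bullet(b\bullet c)=(a\bullet c)\bullet b-a\bullet(c\bullet b)$ and $(a\cdot b)\bullet c=(a\bullet c)\cdot b+a\cdot(b\bullet c)$. A Com-PreLie bialgebra is $(A,\cdot,\bullet,\Delta)$ such that $(A,\cdot,\bullet)$ is a Com-PreLie algebra with a unit for $\cdot$, $(A,\cdot,\Delta)$ is a bialgebra, and $\Delta(a\bullet b)=a^{(1)}\otimes a^{(2)}\bullet b+a^{(1)}\bullet b^{(1)}\otimes a^{(2)}\cdot b^{(2)}$ for all $a,b\in A$ (Sweedler's notation). *)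

theory Defs
  imports Complex_Main "HOL-Library.Poly_Mapping"
begin

section \<open>Free vector spaces\<close>

text \<open>
  \<open>'i \<Rightarrow>\<^sub>0 'k\<close> is the vector space with basis \<open>'i\<close>; the basis vector of \<open>i\<close> is
  \<open>Poly_Mapping.single i 1\<close>.
\<close>

definition fscale :: "'k::field \<Rightarrow> ('i \<Rightarrow>\<^sub>0 'k) \<Rightarrow> ('i \<Rightarrow>\<^sub>0 'k)"
  where "fscale c p = Poly_Mapping.map ((*) c) p"

text \<open>The linear extension of a map defined on the basis.\<close>

definition flift ::
  "('k::field \<Rightarrow> 'v::ab_group_add \<Rightarrow> 'v) \<Rightarrow> ('i \<Rightarrow> 'v) \<Rightarrow> ('i \<Rightarrow>\<^sub>0 'k) \<Rightarrow> 'v"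
  where "flift s f t = (\<Sum>i\<in>Poly_Mapping.keys t. s (Poly_Mapping.lookup t i) (f i))"

definition bilinear_map ::
  "('k::field \<Rightarrow> 'a::ab_group_add \<Rightarrow> 'a) \<Rightarrow> ('k \<Rightarrow> 'v::ab_group_add \<Rightarrow> 'v) \<Rightarrow> ('a \<Rightarrow> 'a \<Rightarrow> 'v) \<Rightarrow> bool"
  where "bilinear_map s s' f \<longleftrightarrow>
    (\<forall>y. Vector_Spaces.linear s s' (\<lambda>x. f x y)) \<and> (\<forall>x. Vector_Spaces.linear s s' (f x))"


section \<open>Tensor powers\<close>

text \<open>
  The tensor square of a vector space is the quotient of the free vector space on pairs by the
  span of the bilinearity relations. The scalar multiplication is a term, not a type, so this
  quotient is not a HOL type: its elements are given by representatives, which are compared by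
  the congruence \<open>tensor_eq\<close>. A map into the tensor square is a map into representatives, and
  all its properties are stated up to \<open>tensor_eq\<close>. The tensor cube is treated in the same way.

  Sweedler notation becomes linear extension: if \<open>f\<close> is bilinear, then
  \<open>f (a\<^sup>(\<^sup>1\<^sup>)) (a\<^sup>(\<^sup>2\<^sup>))\<close> is \<open>flift s (\<lambda>(x, y). f x y) (\<Delta> a)\<close>.

  The product of \<open>('a \<times> 'a) \<Rightarrow>\<^sub>0 'k\<close> from \<open>Poly_Mapping\<close> (convolution over the additive
  group of pairs) plays no role here; the product of the tensor square is \<open>tensor_mult\<close>.
\<close>

type_synonym ('a, 'k) tensor2 = "('a \<times> 'a) \<Rightarrow>\<^sub>0 'k"
type_synonym ('a, 'k) tensor3 = "('a \<times> 'a \<times> 'a) \<Rightarrow>\<^sub>0 'k"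

definition tensor :: "'a \<Rightarrow> 'a \<Rightarrow> ('a, 'k::field) tensor2"
  where "tensor x y = Poly_Mapping.single (x, y) 1"

definition tensor_relations ::
  "('k::field \<Rightarrow> 'a::ab_group_add \<Rightarrow> 'a) \<Rightarrow> ('a, 'k) tensor2 set"
  where "tensor_relations s =
      {tensor (x + x') y - tensor x y - tensor x' y | x x' y. True}
    \<union> {tensor x (y + y') - tensor x y - tensor x y' | x y y'. True}
    \<union> {tensor (s c x) y - fscale c (tensor x y) | c x y. True}
    \<union> {tensor x (s c y) - fscale c (tensor x y) | c x y. True}"

definition tensor_eq ::
  "('k::field \<Rightarrow> 'a::ab_group_add \<Rightarrow> 'a) \<Rightarrow> ('a, 'k) tensor2 \<Rightarrow> ('a, 'k) tensor2 \<Rightarrow> bool"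
  where "tensor_eq s t u \<longleftrightarrow> t - u \<in> module.span fscale (tensor_relations s)"

definition tensor3 :: "'a \<Rightarrow> 'a \<Rightarrow> 'a \<Rightarrow> ('a, 'k::field) tensor3"
  where "tensor3 x y z = Poly_Mapping.single (x, y, z) 1"

definition tensor3_relations ::
  "('k::field \<Rightarrow> 'a::ab_group_add \<Rightarrow> 'a) \<Rightarrow> ('a, 'k) tensor3 set"
  where "tensor3_relations s =
      {tensor3 (x + x') y z - tensor3 x y z - tensor3 x' y z | x x' y z. True}
    \<union> {tensor3 x (y + y') z - tensor3 x y z - tensor3 x y' z | x y y' z. True}
    \<union> {tensor3 x y (z + z') - tensor3 x y z - tensor3 x y z' | x y z z'. True}
    \<union> {tensor3 (s c x) y z - fscale c (tensor3 x y z) | c x y z. True}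
    \<union> {tensor3 x (s c y) z - fscale c (tensor3 x y z) | c x y z. True}
    \<union> {tensor3 x y (s c z) - fscale c (tensor3 x y z) | c x y z. True}"

definition tensor3_eq ::
  "('k::field \<Rightarrow> 'a::ab_group_add \<Rightarrow> 'a) \<Rightarrow> ('a, 'k) tensor3 \<Rightarrow> ('a, 'k) tensor3 \<Rightarrow> bool"
  where "tensor3_eq s t u \<longleftrightarrow> t - u \<in> module.span fscale (tensor3_relations s)"

text \<open>\<open>(x \<otimes> y) (u \<otimes> v) = x u \<otimes> y v\<close>\<close>

definition tensor_mult ::
  "('a \<Rightarrow> 'a \<Rightarrow> 'a) \<Rightarrow> ('a, 'k::field) tensor2 \<Rightarrow> ('a, 'k) tensor2 \<Rightarrow> ('a, 'k) tensor2"
  where "tensor_mult m t t' =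
    flift fscale (\<lambda>(x, y). flift fscale (\<lambda>(u, v). tensor (m x u) (m y v)) t') t"


section \<open>Com-PreLie bialgebras\<close>

locale comm_assoc_algebra = vector_space s
  for s :: "'k::field \<Rightarrow> 'a::ab_group_add \<Rightarrow> 'a" +
  fixes m :: "'a \<Rightarrow> 'a \<Rightarrow> 'a"
  assumes m_bilinear: "bilinear_map s s m"
    and m_assoc: "m (m a b) c = m a (m b c)"
    and m_commute: "m a b = m b a"

locale com_prelie_algebra = comm_assoc_algebra s m
  for s :: "'k::field \<Rightarrow> 'a::ab_group_add \<Rightarrow> 'a" and m :: "'a \<Rightarrow> 'a \<Rightarrow> 'a" +
  fixes p :: "'a \<Rightarrow> 'a \<Rightarrow> 'a"
  assumes p_bilinear: "bilinear_map s s p"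
    and prelie: "p (p a b) c - p a (p b c) = p (p a c) b - p a (p c b)"
    and leibniz: "p (m a b) c = m (p a c) b + m a (p b c)"

text \<open>\<open>\<Delta>\<close> is a morphism of unital algebras from \<open>(A, m, e)\<close> to its tensor square.\<close>

locale tensor_algebra_hom =
  fixes s :: "'k::field \<Rightarrow> 'a::ab_group_add \<Rightarrow> 'a" and m :: "'a \<Rightarrow> 'a \<Rightarrow> 'a" and e :: 'a
    and \<Delta> :: "'a \<Rightarrow> ('a, 'k) tensor2"
  assumes hom_add: "tensor_eq s (\<Delta> (a + b)) (\<Delta> a + \<Delta> b)"
    and hom_scale: "tensor_eq s (\<Delta> (s c a)) (fscale c (\<Delta> a))"
    and hom_mult: "tensor_eq s (\<Delta> (m a b)) (tensor_mult m (\<Delta> a) (\<Delta> b))"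
    and hom_unit: "tensor_eq s (\<Delta> e) (tensor e e)"

locale comm_bialgebra =
  comm_assoc_algebra s m + tensor_algebra_hom s m e \<Delta>
  for s :: "'k::field \<Rightarrow> 'a::ab_group_add \<Rightarrow> 'a" and m :: "'a \<Rightarrow> 'a \<Rightarrow> 'a" and e :: 'a
    and \<Delta> :: "'a \<Rightarrow> ('a, 'k) tensor2" and \<epsilon> :: "'a \<Rightarrow> 'k" +
  assumes m_unit: "m e a = a"
    and coassoc: "tensor3_eq s
      (flift fscale (\<lambda>(x, y). flift fscale (\<lambda>(u, v). tensor3 u v y) (\<Delta> x)) (\<Delta> a))
      (flift fscale (\<lambda>(x, y). flift fscale (\<lambda>(u, v). tensor3 x u v) (\<Delta> y)) (\<Delta> a))"
    and counit_linear: "Vector_Spaces.linear s (*) \<epsilon>"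
    and counit_mult: "\<epsilon> (m a b) = \<epsilon> a * \<epsilon> b"
    and counit_unit: "\<epsilon> e = 1"
    and counit_left: "flift s (\<lambda>(x, y). s (\<epsilon> x) y) (\<Delta> a) = a"
    and counit_right: "flift s (\<lambda>(x, y). s (\<epsilon> y) x) (\<Delta> a) = a"

text \<open>The unit and the counit are unique when they exist, hence the existential quantifier.\<close>

locale com_prelie_bialgebra = com_prelie_algebra s m p
  for s :: "'k::field \<Rightarrow> 'a::ab_group_add \<Rightarrow> 'a" and m p :: "'a \<Rightarrow> 'a \<Rightarrow> 'a" +
  fixes \<Delta> :: "'a \<Rightarrow> ('a, 'k) tensor2"
  assumes bialgebra: "\<exists>e \<epsilon>. comm_bialgebra s m e \<Delta> \<epsilon>"
    and prelie_coproduct: "tensor_eq s (\<Delta> (p a b))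
      (flift fscale (\<lambda>(x, y). tensor x (p y b)) (\<Delta> a) +
       flift fscale (\<lambda>(x, y). flift fscale (\<lambda>(u, v). tensor (p x u) (m y v)) (\<Delta> b)) (\<Delta> a))"


section \<open>Laurent polynomials\<close>

text \<open>
  For the index type \<open>int\<close>, the product of \<open>Poly_Mapping\<close> is convolution over the additive
  group of integers, so \<open>int \<Rightarrow>\<^sub>0 'k\<close> is the algebra of Laurent polynomials.
\<close>

type_synonym 'k laurent = "int \<Rightarrow>\<^sub>0 'k"

definition X_pow :: "int \<Rightarrow> 'k::field laurent"
  where "X_pow n = Poly_Mapping.single n 1"

lemma X_pow_0: "X_pow 0 = 1"
  by (simp add: X_pow_def)

lemma X_pow_add: "X_pow (k + l) = X_pow k * X_pow l"
  by (simp add: X_pow_def mult_single)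


section \<open>Consistency of the definitions\<close>

lemma lookup_fscale [simp]: "Poly_Mapping.lookup (fscale c p) i = c * Poly_Mapping.lookup p i"
  by (simp add: fscale_def Poly_Mapping.map.rep_eq when_def)

lemma fscale_single: "fscale c (Poly_Mapping.single i d) = Poly_Mapping.single i (c * d)"
  by (simp add: fscale_def)

lemma vector_space_fscale: "vector_space fscale"
  by unfold_locales (auto intro!: poly_mapping_eqI simp: lookup_add algebra_simps)

lemma flift_superset:
  assumes "vector_space s" "finite A" "Poly_Mapping.keys t \<subseteq> A"
  shows "flift s f t = (\<Sum>i\<in>A. s (Poly_Mapping.lookup t i) (f i))"
proof -
  interpret vector_space s by fact
  show ?thesis
    unfolding flift_def using assms(2,3)
    by (intro sum.mono_neutral_left) (auto simp: in_keys_iff)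
qed

lemma flift_single:
  assumes "vector_space s"
  shows "flift s f (Poly_Mapping.single i c) = s c (f i)"
proof -
  interpret vector_space s by fact
  show ?thesis by (subst flift_superset[of s "{i}"]) (auto simp: assms)
qed

lemma poly_mapping_single_add_induct [case_names single add]:
  fixes t :: "'i \<Rightarrow>\<^sub>0 'k::field"
  assumes single: "\<And>i c. P (Poly_Mapping.single i c)"
    and add: "\<And>t u. P t \<Longrightarrow> P u \<Longrightarrow> P (t + u)"
  shows "P t"
proof -
  have "P (\<Sum>i\<in>A. Poly_Mapping.single i (Poly_Mapping.lookup t i))" if "finite A" for A
    using that
  proof (induction A rule: finite_induct)
    case empty
    then show ?case using single[of undefined 0] by simp
  next
    case (insert i A)
    then show ?case by (simp add: add single)
  qed
  moreover have "t = (\<Sum>i\<in>Poly_Mapping.keys t. Poly_Mapping.single i (Poly_Mapping.lookup t i))"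
    by (rule poly_mapping_eqI)
      (auto simp: lookup_sum lookup_single when_def sum.delta in_keys_iff)
  ultimately show ?thesis by (metis finite_keys)
qed

lemma linear_flift:
  assumes "vector_space s"
  shows "Vector_Spaces.linear fscale s (flift s f)"
proof -
  interpret F: vector_space fscale by (rule vector_space_fscale)
  interpret vector_space s by fact
  show ?thesis
  proof (unfold_locales, goal_cases)
    case (1 t u)
    let ?A = "Poly_Mapping.keys t \<union> Poly_Mapping.keys u"
    have "Poly_Mapping.keys (t + u) \<subseteq> ?A" by (rule keys_add)
    then show ?case
      by (simp add: flift_superset[OF assms, of ?A] lookup_add scale_left_distrib sum.distrib)
  next
    case (2 c t)
    have "Poly_Mapping.keys (fscale c t) \<subseteq> Poly_Mapping.keys t" by (auto simp: in_keys_iff)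
    then show ?case
      by (simp add: flift_superset[OF assms, of "Poly_Mapping.keys t"] scale_sum_right)
  qed
qed

text \<open>The linear extension of a bilinear map does not depend on representatives.\<close>

lemma flift_tensor_eq:
  assumes "vector_space s'" "bilinear_map s s' f" "tensor_eq s t u"
  shows "flift s' (\<lambda>(x, y). f x y) t = flift s' (\<lambda>(x, y). f x y) u"
proof -
  let ?L = "flift s' (\<lambda>(x, y). f x y)"
  interpret F: vector_space fscale by (rule vector_space_fscale)
  interpret S: vector_space s' by fact
  interpret L: Vector_Spaces.linear fscale s' ?L by (rule linear_flift[OF assms(1)])
  have [simp]: "?L (tensor x y) = f x y" for x y
    by (simp add: tensor_def flift_single[OF assms(1)])
  have l: "Vector_Spaces.linear s s' (\<lambda>x. f x y)" and r: "Vector_Spaces.linear s s' (f x)" for x y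
    using assms(2) by (auto simp: bilinear_map_def)
  note h = module_hom.add[OF Vector_Spaces.linear.axioms(3)]
    module_hom.scale[OF Vector_Spaces.linear.axioms(3)]
  have "?L w = 0" if "w \<in> tensor_relations s" for w
    using that unfolding tensor_relations_def
    by (auto simp: L.diff L.scale h[OF l] h[OF r])
  then have "F.span (tensor_relations s) \<subseteq> {w. ?L w = 0}"
    by (intro F.span_minimal) (auto simp: F.subspace_def L.zero L.add L.scale)
  then have "?L (t - u) = 0"
    using assms(3) by (auto simp: tensor_eq_def)
  then show ?thesis by (simp add: L.diff)
qed

text \<open>The Laurent polynomial algebra has an algebra morphism \<open>\<Delta>\<close> with \<open>\<Delta> X = X \<otimes> X\<close>.\<close>

lemma ex_laurent_coproduct:
  "\<exists>\<Delta> :: 'k::field laurent \<Rightarrow> ('k laurent, 'k) tensor2.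
    tensor_algebra_hom fscale (*) 1 \<Delta> \<and> tensor_eq fscale (\<Delta> (X_pow 1)) (tensor (X_pow 1) (X_pow 1))"
proof -
  interpret F: vector_space "fscale :: 'k \<Rightarrow> ('k laurent, 'k) tensor2 \<Rightarrow> _"
    by (rule vector_space_fscale)
  interpret G: vector_space "fscale :: 'k \<Rightarrow> 'k laurent \<Rightarrow> _"
    by (rule vector_space_fscale)
  have refl: "tensor_eq fscale t t" for t :: "('k laurent, 'k) tensor2"
    by (simp add: tensor_eq_def F.span_zero)
  define D :: "'k laurent \<Rightarrow> ('k laurent, 'k) tensor2"
    where "D = flift fscale (\<lambda>n. tensor (X_pow n) (X_pow n))"
  interpret D: Vector_Spaces.linear fscale fscale D
    unfolding D_def by (rule linear_flift) (rule vector_space_fscale)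
  have D_single: "D (Poly_Mapping.single n c) = fscale c (tensor (X_pow n) (X_pow n))" for n c
    by (simp add: D_def flift_single[OF vector_space_fscale])
  have add_left: "tensor_mult m (t + t') u = tensor_mult m t u + tensor_mult m t' u"
    for m and t t' u :: "('k laurent, 'k) tensor2"
  proof -
    interpret L: Vector_Spaces.linear fscale fscale
      "flift fscale (\<lambda>(x, y). flift fscale (\<lambda>(v, w). tensor (m x v) (m y w)) u)
        :: ('k laurent, 'k) tensor2 \<Rightarrow> ('k laurent, 'k) tensor2"
      by (rule linear_flift) (rule vector_space_fscale)
    show ?thesis by (simp only: tensor_mult_def L.add)
  qed
  have add_right: "tensor_mult m t (u + u') = tensor_mult m t u + tensor_mult m t u'"
    for m and t u u' :: "('k laurent, 'k) tensor2"
  proof -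
    have *: "flift fscale (\<lambda>(v, w). tensor (m x v) (m y w)) (u + u') =
        flift fscale (\<lambda>(v, w). tensor (m x v) (m y w)) u +
        (flift fscale (\<lambda>(v, w). tensor (m x v) (m y w)) u' :: ('k laurent, 'k) tensor2)" for x y
    proof -
      interpret L: Vector_Spaces.linear fscale fscale
        "flift fscale (\<lambda>(v, w). tensor (m x v) (m y w))
          :: ('k laurent, 'k) tensor2 \<Rightarrow> ('k laurent, 'k) tensor2"
        by (rule linear_flift) (rule vector_space_fscale)
      show ?thesis by (rule L.add)
    qed
    show ?thesis
      unfolding tensor_mult_def * flift_def[of _ _ t]
      by (simp add: split_def F.scale_right_distrib sum.distrib)
  qed
  have mult: "D (a * b) = tensor_mult (*) (D a) (D b)" for a b
  proof (induction a rule: poly_mapping_single_add_induct)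
    case (single n c)
    show ?case
    proof (induction b rule: poly_mapping_single_add_induct)
      case (single k d)
      show ?case
        by (simp add: mult_single D_single tensor_def fscale_single tensor_mult_def X_pow_add
            flift_single[OF vector_space_fscale])
    next
      case (add f g)
      then show ?case by (simp add: distrib_left D.add add_right)
    qed
  next
    case (add f g)
    then show ?case by (simp add: distrib_right D.add add_left)
  qed
  have "D (X_pow n) = tensor (X_pow n) (X_pow n)" for n
    by (subst X_pow_def) (simp add: D_single)
  from this[of 0] this[of 1] show ?thesis
    by (intro exI[of _ D] conjI tensor_algebra_hom.intro)
       (simp_all add: refl D.add D.scale mult X_pow_0)
qed

end

theory Submission
  imports Defs
begin

text \<open>
  Every power \<open>X\<^sup>n\<close> is grouplike, so for a bilinear product \<open>\<bullet>\<close> the compatibility of \<open>P = X\<^sup>k \<bullet> X\<^sup>l\<close> with the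
  coproduct reads \<open>\<Delta> P = X\<^sup>k \<otimes> P + P \<otimes> X\<^sup>k\<^sup>+\<^sup>l\<close>, that is, \<open>P\<close> is skew-primitive. The skew-primitive elements
  between two grouplike elements \<open>g\<close> and \<open>h\<close> of this coalgebra are the multiples of \<open>g - h\<close>.
  The Leibniz rule makes \<open>X\<^sup>k \<bullet> X\<^sup>l\<close> linear in \<open>k\<close>, hence \<open>X\<^sup>k \<bullet> X\<^sup>l = b\<^sub>l k (X\<^sup>k - X\<^sup>k\<^sup>+\<^sup>l)\<close> for scalars
  \<open>b\<^sub>l\<close>, and one may take \<open>b\<^sub>0 = 0\<close>. For such a product the pre-Lie identity becomes
  \<open>(l b\<^sub>m - m b\<^sub>l) b\<^sub>l\<^sub>+\<^sub>m = (l - m) b\<^sub>l b\<^sub>m\<close> whenever \<open>l + m \<noteq> 0\<close>. This reduction is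
  \<open>com_prelie_bialgebra_iff\<close>.

  It remains to solve this functional equation (\<open>prelie_sequence_cases\<close>). If the support \<open>S\<close>
  of \<open>b\<close> has at most one element, \<open>b\<close> belongs to the first or the second family. If \<open>S\<close> has two
  elements, the equation forces \<open>S \<union> {0}\<close> to be closed under differences, hence to be \<open>N \<int>\<close> for
  some \<open>N \<ge> 1\<close>. On \<open>S\<close> one can divide by \<open>b\<^sub>l b\<^sub>m b\<^sub>l\<^sub>+\<^sub>m\<close>, and the equation becomes linear in
  \<open>e\<^sub>n = 1 / b\<^sub>N\<^sub>n\<close>, namely \<open>n e\<^sub>n - m e\<^sub>m = (n - m) e\<^sub>n\<^sub>+\<^sub>m\<close>. Its solutions are the affine functions of \<open>n\<close>,
  determined by \<open>\<alpha> = b\<^sub>N\<close> and \<open>\<beta> = b\<^sub>2\<^sub>N\<close>. This is the third family, and the condition on \<open>\<alpha>\<close>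
  and \<open>\<beta>\<close> says that \<open>e\<^sub>n \<noteq> 0\<close> for \<open>n \<noteq> 0\<close>.

  Elements of the tensor square are only given up to \<open>tensor_eq\<close>, and \<open>\<Delta>\<close> is an arbitrary choice
  of representatives. All tensor computations therefore go through bilinear forms: two
  representatives are equivalent iff all bilinear forms agree on them (\<open>tensor_eq_iff_forms\<close>),
  and a bilinear map evaluated on \<open>\<Delta> a\<close> depends on the values at the pairs \<open>(X\<^sup>n, X\<^sup>n)\<close> only
  (\<open>flift_coproduct\<close>).
\<close>

section \<open>Bilinear maps and the tensor square\<close>

lemma vector_space_mult: "vector_space ((*) :: 'k::field \<Rightarrow> 'k \<Rightarrow> 'k)"
  by unfold_locales (simp_all add: algebra_simps)

lemma bilinear_map_iff:
  "bilinear_map s s' f \<longleftrightarrow> vector_space s \<and> vector_space s' \<and>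
    (\<forall>x x' y. f (x + x') y = f x y + f x' y) \<and> (\<forall>x y y'. f x (y + y') = f x y + f x y') \<and>
    (\<forall>c x y. f (s c x) y = s' c (f x y)) \<and> (\<forall>c x y. f x (s c y) = s' c (f x y))"
  by (auto simp: bilinear_map_def Vector_Spaces.linear_iff)

lemma linear_apply_flift:
  assumes "Vector_Spaces.linear s s' L"
  shows "L (flift s f t) = flift s' (\<lambda>i. L (f i)) t"
proof -
  interpret Vector_Spaces.linear s s' L by fact
  show ?thesis by (simp add: flift_def sum scale)
qed

lemma flift_of_linear:
  assumes "Vector_Spaces.linear fscale s L"
  shows "flift s (\<lambda>i. L (Poly_Mapping.single i 1)) t = L t"
proof -
  interpret L: Vector_Spaces.linear fscale s L by fact
  note lin = linear_flift[OF L.vs2.vector_space_axioms, of "\<lambda>i. L (Poly_Mapping.single i 1)"]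
  interpret F: Vector_Spaces.linear fscale s "flift s (\<lambda>i. L (Poly_Mapping.single i 1))" by (fact lin)
  show ?thesis
  proof (induction t rule: poly_mapping_single_add_induct)
    case (single i c)
    have "L (Poly_Mapping.single i c) = s c (L (Poly_Mapping.single i 1))"
      by (simp add: fscale_single flip: L.scale)
    then show ?case by (simp add: flift_single[OF L.vs2.vector_space_axioms])
  next
    case (add t u)
    then show ?case by (simp add: F.add L.add add)
  qed
qed

text \<open>
  Extending a basis of the span of \<open>S\<close> by \<open>v\<close> gives a functional that is \<open>1\<close> on \<open>v\<close> and
  vanishes on \<open>S\<close>.
\<close>

lemma separating_functional:
  assumes "vector_space (s :: 'k::field \<Rightarrow> 'v::ab_group_add \<Rightarrow> 'v)" "v \<notin> module.span s S"
  obtains g where "Vector_Spaces.linear s (*) g" "\<And>x. x \<in> S \<Longrightarrow> g x = 0" "g v \<noteq> (0 :: 'k)"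
proof -
  interpret vector_space s by fact
  interpret K: vector_space "(*) :: 'k \<Rightarrow> 'k \<Rightarrow> 'k" by (rule vector_space_mult)
  interpret P: vector_space_pair s "(*) :: 'k \<Rightarrow> 'k \<Rightarrow> 'k" ..
  obtain B where B: "B \<subseteq> S" "independent B" "S \<subseteq> span B"
    by (rule maximal_independent_subset)
  have eq: "span B = span S"
    using B by (metis span_mono span_span subset_antisym)
  have "independent (insert v B)"
    using B(2) assms(2) eq by (simp add: independent_insert)
  then obtain g where g: "Vector_Spaces.linear s (*) g"
      "\<forall>x\<in>insert v B. g x = (if x = v then 1 else 0 :: 'k)"
    using P.linear_independent_extend[of "insert v B" "\<lambda>x. if x = v then 1 else 0"] by blast
  have "v \<notin> B" using assms(2) eq span_base by blast
  then have "g x = 0" if "x \<in> B" for x using g(2) that by auto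
  then have "g x = 0" if "x \<in> S" for x
    using P.linear_eq_0_on_span[OF g(1), of B x] B(3) that by blast
  with g show ?thesis by (intro that[of g]) auto
qed

text \<open>
  Functionals on the free vector space that vanish on the relations are the same as bilinear
  forms, and such functionals separate the points of the quotient. This replaces every
  computation with congruences by one with scalars.
\<close>

lemma tensor_eq_iff_forms:
  fixes s :: "'k::field \<Rightarrow> 'a::ab_group_add \<Rightarrow> 'a"
  assumes "vector_space s"
  shows "tensor_eq s t u \<longleftrightarrow> (\<forall>B. bilinear_map s (*) B \<longrightarrow>
    flift (*) (\<lambda>(x, y). B x y) t = flift (*) (\<lambda>(x, y). B x y) u)" (is "_ \<longleftrightarrow> ?R")
proof
  assume "tensor_eq s t u"
  then show ?R using flift_tensor_eq vector_space_mult by blast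
next
  assume R: ?R
  show "tensor_eq s t u"
  proof (rule ccontr)
    assume "\<not> tensor_eq s t u"
    then obtain g where g: "Vector_Spaces.linear fscale (*) g" "g (t - u) \<noteq> (0 :: 'k)"
        "\<And>x. x \<in> tensor_relations s \<Longrightarrow> g x = 0"
      unfolding tensor_eq_def using separating_functional[OF vector_space_fscale] by metis
    interpret g: Vector_Spaces.linear fscale "(*)" g by fact
    define B where "B x y = g (tensor x y)" for x y
    have rel: "tensor (x + x') y - tensor x y - tensor x' y \<in> tensor_relations s"
        "tensor x (y + y') - tensor x y - tensor x y' \<in> tensor_relations s"
        "tensor (s c x) y - fscale c (tensor x y) \<in> tensor_relations s"
        "tensor x (s c y) - fscale c (tensor x y) \<in> tensor_relations s" for x x' y y' c
      unfolding tensor_relations_def by blast+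
    have "bilinear_map s (*) B"
      using rel[THEN g(3)] assms
      by (simp add: bilinear_map_iff vector_space_mult B_def g.diff g.add g.scale diff_diff_eq)
    moreover have "flift (*) (\<lambda>(x, y). B x y) w = g w" for w
      using flift_of_linear[OF g(1), of w] by (simp add: B_def tensor_def split_def)
    ultimately show False using R[rule_format, of B] g(2) by (simp add: g.diff)
  qed
qed

text \<open>
  The same argument for the tensor cube. A trilinear form is described by its bilinearity in the
  first two and in the last two arguments.
\<close>

lemma tensor3_eqI_forms:
  fixes s :: "'k::field \<Rightarrow> 'a::ab_group_add \<Rightarrow> 'a"
  assumes "vector_space s"
    and forms: "\<And>B. (\<And>z. bilinear_map s (*) (\<lambda>x y. B x y z)) \<Longrightarrow>
      (\<And>x. bilinear_map s (*) (B x)) \<Longrightarrow>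
      flift (*) (\<lambda>(x, y, z). B x y z) t = flift (*) (\<lambda>(x, y, z). B x y z) u"
  shows "tensor3_eq s t u"
proof (rule ccontr)
  assume "\<not> tensor3_eq s t u"
  then obtain g where g: "Vector_Spaces.linear fscale (*) g" "g (t - u) \<noteq> (0 :: 'k)"
      "\<And>x. x \<in> tensor3_relations s \<Longrightarrow> g x = 0"
    unfolding tensor3_eq_def using separating_functional[OF vector_space_fscale] by metis
  interpret g: Vector_Spaces.linear fscale "(*)" g by fact
  define B where "B x y z = g (tensor3 x y z)" for x y z
  have rel: "g (tensor3 (x + x') y z - tensor3 x y z - tensor3 x' y z) = 0"
      "g (tensor3 x (y + y') z - tensor3 x y z - tensor3 x y' z) = 0"
      "g (tensor3 x y (z + z') - tensor3 x y z - tensor3 x y z') = 0"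
      "g (tensor3 (s c x) y z - fscale c (tensor3 x y z)) = 0"
      "g (tensor3 x (s c y) z - fscale c (tensor3 x y z)) = 0"
      "g (tensor3 x y (s c z) - fscale c (tensor3 x y z)) = 0"
    for x x' y y' z z' c
    by (rule g(3), unfold tensor3_relations_def, fastforce)+
  have "bilinear_map s (*) (\<lambda>x y. B x y z)" "bilinear_map s (*) (B x)" for x z
    using rel assms
    by (simp_all add: bilinear_map_iff vector_space_mult B_def g.diff g.add g.scale diff_diff_eq)
  moreover have "flift (*) (\<lambda>(x, y, z). B x y z) w = g w" for w
    using flift_of_linear[OF g(1), of w] by (simp add: B_def tensor3_def split_def)
  ultimately show False using forms[of B] g(2) by (simp add: g.diff)
qed

lemma flift_cong: "(\<And>i. f i = g i) \<Longrightarrow> flift s f t = flift s g t"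
  by (simp add: flift_def)

lemma flift_add_fun:
  assumes "vector_space s"
  shows "flift s (\<lambda>i. f i + g i) t = flift s f t + flift s g t"
proof -
  interpret vector_space s by fact
  show ?thesis by (simp add: flift_def scale_right_distrib sum.distrib)
qed

lemma flift_scale_fun:
  assumes "vector_space s"
  shows "flift s (\<lambda>i. s c (f i)) t = s c (flift s f t)"
proof -
  interpret vector_space s by fact
  show ?thesis by (simp add: flift_def scale_sum_right mult.commute)
qed

lemma flift_add: "vector_space s \<Longrightarrow> flift s f (t + u) = flift s f t + flift s f u"
  and flift_fscale: "vector_space s \<Longrightarrow> flift s f (fscale c t) = s c (flift s f t)"
  using linear_flift[of s f] by (simp_all add: Vector_Spaces.linear_iff)

lemma bilinear_flift:
  assumes s: "vector_space s" and f: "\<And>i. bilinear_map s' s (f i)"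
  shows "bilinear_map s' s (\<lambda>x y. flift s (\<lambda>i. f i x y) t)"
  using f by (simp add: bilinear_map_iff s flift_add_fun[OF s] flift_scale_fun[OF s])

lemma flift_tensor:
  assumes "vector_space s"
  shows "flift s (\<lambda>(x, y). f x y) (tensor x y) = f x y"
proof -
  interpret vector_space s by fact
  show ?thesis by (simp add: tensor_def flift_single[OF assms])
qed

section \<open>Laurent polynomials\<close>

lemma laurent_induct [case_names X_pow add scale]:
  fixes f :: "'k::field laurent"
  assumes "\<And>n. P (X_pow n)" and "\<And>f g. P f \<Longrightarrow> P g \<Longrightarrow> P (f + g)"
    and "\<And>c f. P f \<Longrightarrow> P (fscale c f)"
  shows "P f"
proof (induction f rule: poly_mapping_single_add_induct)
  case (single n c)
  show ?case using assms(3)[OF assms(1), of c n] by (simp add: X_pow_def fscale_single)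
next
  case (add f g)
  then show ?case by (rule assms(2))
qed

lemma fscale_add: "fscale c (t + u) = fscale c t + fscale c u"
  by (rule poly_mapping_eqI) (simp add: lookup_add distrib_left)

text \<open>
  Scalars act as constant polynomials, so that the ring laws apply to \<open>fscale\<close>.
\<close>

lemma fscale_eq_mult: "fscale c f = Poly_Mapping.single 0 c * (f :: 'k::field laurent)"
  by (induction f rule: poly_mapping_single_add_induct)
    (simp_all add: fscale_single mult_single distrib_left fscale_add)

lemma fscale_mult: "fscale c f * g = fscale c (f * g)" "g * fscale c f = fscale c (g * (f :: 'k::field laurent))"
  by (simp_all add: fscale_eq_mult mult.assoc mult.left_commute)

lemma bilinear_mult: "bilinear_map fscale fscale ((*) :: 'k::field laurent \<Rightarrow> _)"
  by (simp add: bilinear_map_iff vector_space_fscale fscale_eq_mult algebra_simps)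

lemma lookup_X_pow: "Poly_Mapping.lookup (X_pow n) i = (if i = n then 1 else 0)"
  by (auto simp: X_pow_def lookup_single when_def)

lemma flift_X_pow:
  assumes "vector_space s"
  shows "flift s f (X_pow n) = f n"
proof -
  interpret vector_space s by fact
  show ?thesis by (simp add: X_pow_def flift_single[OF assms])
qed

lemma bilinear_translate:
  fixes f :: "'k::field laurent \<Rightarrow> 'k laurent \<Rightarrow> 'v::ab_group_add"
  assumes "bilinear_map fscale s f"
  shows "bilinear_map fscale s (\<lambda>u v. f (a * u) (b * v))"
  using assms
  by (simp add: bilinear_map_iff distrib_left fscale_mult)

lemma bilinear_translate':
  fixes f :: "'k::field laurent \<Rightarrow> 'k laurent \<Rightarrow> 'v::ab_group_add"
  assumes "bilinear_map fscale s f"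
  shows "bilinear_map fscale s (\<lambda>u v. f (u * a) (v * b))"
  using assms by (simp add: bilinear_map_iff distrib_right fscale_mult)

lemma comm_assoc_algebra_laurent:
  "comm_assoc_algebra fscale ((*) :: 'k::field laurent \<Rightarrow> 'k laurent \<Rightarrow> 'k laurent)"
  by (intro comm_assoc_algebra.intro comm_assoc_algebra_axioms.intro vector_space_fscale bilinear_mult)
    (simp_all add: mult_ac)

section \<open>Structure constants satisfying the pre-Lie identity\<close>

text \<open>
  The pre-Lie identity for the product \<open>X\<^sup>k \<bullet> X\<^sup>l = b\<^sub>l k (X\<^sup>k - X\<^sup>k\<^sup>+\<^sup>l)\<close>; see \<open>prelie_X_pow\<close>. The
  pairs with \<open>l + m = 0\<close> are exempt because for them the identity is multiplied by
  \<open>X\<^sup>k - X\<^sup>k\<^sup>+\<^sup>l\<^sup>+\<^sup>m = 0\<close>.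
\<close>

definition prelie_sequence :: "(int \<Rightarrow> 'k::field) \<Rightarrow> bool"
  where "prelie_sequence b \<longleftrightarrow> (\<forall>l m. l + m \<noteq> 0 \<longrightarrow>
    (of_int l * b m - of_int m * b l) * b (l + m) = of_int (l - m) * b l * b m)"

lemma prelie_sequence_single:
  "k0 \<noteq> 0 \<Longrightarrow> prelie_sequence (\<lambda>l. if l = k0 then a else 0)"
  by (auto simp: prelie_sequence_def)

text \<open>
  With \<open>p\<close>, \<open>q\<close>, \<open>r\<close> the values of the affine function \<open>n \<mapsto> A n + B\<close> at \<open>i\<close>, \<open>j\<close>, \<open>i + j\<close>, the identity is
  \<open>i p - j q = (i - j) r\<close> divided by \<open>p q r\<close>, for \<open>l = N i\<close> and \<open>m = N j\<close>. If \<open>N\<close> fails to divide one of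
  \<open>l\<close> and \<open>m\<close>, both sides vanish, because then \<open>N\<close> cannot divide both \<open>l + m\<close> and the other one.
\<close>

lemma prelie_sequence_affine:
  fixes A B :: "'k::field"
  assumes N: "N \<ge> 1" and nz: "\<And>n. n \<noteq> 0 \<Longrightarrow> of_int n * A + B \<noteq> 0"
  shows "prelie_sequence (\<lambda>l. if l = 0 then 0 else if N dvd l
    then inverse (of_int (l div N) * A + B) else 0)" (is "prelie_sequence ?b")
  unfolding prelie_sequence_def
proof (intro allI impI)
  fix l m :: int assume lm: "l + m \<noteq> 0"
  show "(of_int l * ?b m - of_int m * ?b l) * ?b (l + m) = of_int (l - m) * ?b l * ?b m"
  proof (cases "l \<noteq> 0 \<and> m \<noteq> 0 \<and> N dvd l \<and> N dvd m")
    case True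
    then obtain i j where ij: "l = N * i" "m = N * j" by (auto elim!: dvdE)
    have "l + m = N * (i + j)" by (simp add: ij distrib_left)
    with ij True lm have nz0: "i \<noteq> 0" "j \<noteq> 0" "i + j \<noteq> 0" by auto
    define p q r where pqr: "p = of_int i * A + B" "q = of_int j * A + B" "r = of_int (i + j) * A + B"
    have "p \<noteq> 0" "q \<noteq> 0" "r \<noteq> 0" unfolding pqr by (intro nz nz0)+
    moreover have "of_int i * p - of_int j * q = of_int (i - j) * r"
      by (simp add: pqr algebra_simps)
    moreover from calculation have "(of_int i * inverse q - of_int j * inverse p) * inverse r =
        (of_int i * p - of_int j * q) / (p * q * r)"
      by (simp add: field_simps)
    ultimately have pqr_eq: "(of_int i * inverse q - of_int j * inverse p) * inverse r =
        of_int (i - j) * inverse p * inverse q"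
      by (simp add: divide_inverse)
    have b: "?b l = inverse p" "?b m = inverse q" "?b (l + m) = inverse r"
      using N nz0 lm by (simp_all add: ij pqr flip: distrib_left)
    have "(of_int l * inverse q - of_int m * inverse p) * inverse r =
        of_int N * ((of_int i * inverse q - of_int j * inverse p) * inverse r)"
      by (simp add: ij algebra_simps)
    also have "\<dots> = of_int (l - m) * inverse p * inverse q"
      unfolding pqr_eq by (simp add: ij algebra_simps)
    finally show ?thesis unfolding b .
  next
    case False
    then show ?thesis using lm
      by (auto simp: dvd_add_right_iff dvd_add_left_iff)
  qed
qed

text \<open>
  Division with remainder by the least positive element.
\<close>

lemma int_subgroup_generator:
  fixes H :: "int set"
  assumes diff: "\<And>x y. x \<in> H \<Longrightarrow> y \<in> H \<Longrightarrow> x - y \<in> H" and nz: "x \<in> H" "x \<noteq> 0"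
  obtains N where "N \<ge> 1" "\<And>y. y \<in> H \<longleftrightarrow> int N dvd y"
proof -
  have zero: "0 \<in> H" using diff[OF nz(1) nz(1)] by simp
  have neg: "- y \<in> H" if "y \<in> H" for y using diff[OF zero that] by simp
  have add: "y + z \<in> H" if "y \<in> H" "z \<in> H" for y z using diff[OF that(1) neg[OF that(2)]] by simp
  define N where "N = (LEAST n. n > 0 \<and> int n \<in> H)"
  have "\<exists>n>0. int n \<in> H"
    using nz neg[OF nz(1)] by (intro exI[of _ "nat \<bar>x\<bar>"]) (auto simp: abs_if)
  then have N: "N > 0" "int N \<in> H" unfolding N_def by (metis (mono_tags, lifting) LeastI_ex)+
  have least: "N \<le> n" if "n > 0" "int n \<in> H" for n
    unfolding N_def using that by (simp add: Least_le)
  have mult: "int N * k \<in> H" for k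
    by (induction k rule: int_induct[where k = 0]) (auto simp: zero algebra_simps intro: add diff N)
  show ?thesis
  proof
    show "N \<ge> 1" using N by simp
    fix y
    show "y \<in> H \<longleftrightarrow> int N dvd y"
    proof
      assume y: "y \<in> H"
      have "y mod int N \<in> H"
        using diff[OF y mult[of "y div int N"]] by (simp add: minus_mult_div_eq_mod)
      moreover have lt: "y mod int N < int N" using N(1) by simp
      ultimately have "\<not> y mod int N > 0"
        using least[of "nat (y mod int N)"] lt by (auto simp: le_nat_iff)
      then show "int N dvd y"
        using N(1) pos_mod_sign[of "int N" y] unfolding dvd_eq_mod_eq_0 by linarith
    next
      assume "int N dvd y" then show "y \<in> H" using mult by (auto elim: dvdE)
    qed
  qed
qed

text \<open>
  The right-hand side is the affine function that agrees with \<open>e\<close> at \<open>1\<close> and \<open>2\<close>. It satisfies the same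
  linear recurrence, so the difference \<open>f\<close> does, and \<open>f\<close> vanishes at \<open>1\<close> and \<open>2\<close>. The instance
  \<open>(n, 1)\<close> propagates this to all positive arguments, and the instance \<open>(1 - n, n)\<close>, where the right-hand
  side is a multiple of \<open>f 1 = 0\<close>, carries it over to the negative ones.
\<close>

lemma affine_of_recurrence:
  fixes e :: "int \<Rightarrow> 'k::field_char_0"
  assumes rec: "\<And>n m. n \<noteq> 0 \<Longrightarrow> m \<noteq> 0 \<Longrightarrow> n + m \<noteq> 0 \<Longrightarrow>
    of_int n * e n - of_int m * e m = of_int (n - m) * e (n + m)"
  assumes "n \<noteq> 0"
  shows "e n = of_int (n - 1) * e 2 - of_int (n - 2) * e 1"
proof -
  define f where "f n = e n - (of_int (n - 1) * e 2 - of_int (n - 2) * e 1)" for n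
  have f: "of_int n * f n - of_int m * f m = of_int (n - m) * f (n + m)"
    if "n \<noteq> 0" "m \<noteq> 0" "n + m \<noteq> 0" for n m
    using rec[OF that] by (simp add: f_def algebra_simps)
  have f12: "f 1 = 0" "f 2 = 0" by (simp_all add: f_def)
  have pos: "f (int k + 2) = 0" for k
  proof (induction k)
    case 0
    then show ?case by (simp add: f12)
  next
    case (Suc k)
    \<comment> \<open>the recurrence at \<open>(k + 2, 1)\<close>\<close>
    have "of_nat (Suc k) * f (int k + 3) = 0"
      using f[of "int k + 2" 1] Suc by (simp add: f12 algebra_simps)
    then have "f (int k + 3) = 0"
      using of_nat_neq_0[of k] mult_eq_0_iff by blast
    then show ?case by (simp add: algebra_simps)
  qed
  have "f n = 0"
  proof (cases "n > 0")
    case True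
    then show ?thesis using pos[of "nat (n - 2)"] f12 by (cases "n = 1") auto
  next
    case False
    with \<open>n \<noteq> 0\<close> have n: "n < 0" by simp
    have "f (1 - n) = 0" using pos[of "nat (-1 - n)"] n by (simp add: algebra_simps)
    then show ?thesis using f[of "1 - n" n] n by (simp add: f12)
  qed
  then show ?thesis by (simp add: f_def)
qed

text \<open>
  If \<open>l\<close> and \<open>n \<noteq> l\<close> are in the support but \<open>n - l\<close> is not, the identity for the pair \<open>(l, n - l)\<close> reduces to
  \<open>(n - l) b\<^sub>l b\<^sub>n = 0\<close>, which is impossible in characteristic zero. So the support is closed under differences
  of distinct elements. With two elements in the support this gives opposites as well,
  and the support together with \<open>0\<close> is a subgroup of the integers.
\<close>

lemma prelie_sequence_support:
  fixes b :: "int \<Rightarrow> 'k::field_char_0"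
  assumes b: "prelie_sequence b" and b0: "b 0 = 0"
    and two: "x \<noteq> y" "b x \<noteq> 0" "b y \<noteq> 0"
  obtains N where "N \<ge> 1" "\<And>l. b l \<noteq> 0 \<longleftrightarrow> l \<noteq> 0 \<and> int N dvd l"
proof -
  define S where "S = {l. b l \<noteq> 0}"
  have S0: "0 \<notin> S" using b0 by (simp add: S_def)
  have diff: "n - l \<in> S" if "n \<in> S" "l \<in> S" "n \<noteq> l" for n l
  proof (rule ccontr)
    assume "n - l \<notin> S"
    then have "of_int (n - l) * b l * b n = 0"
      using b[unfolded prelie_sequence_def, rule_format, of l "n - l"] that S0
      by (auto simp: S_def)
    then show False using that by (auto simp: S_def simp del: of_int_diff)
  qed
  have neg: "- l \<in> S" if l: "l \<in> S" for l
  proof -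
    \<comment> \<open>\<open>- l = (n - l) - n\<close> for any second element \<open>n\<close> of the support\<close>
    obtain n where n: "n \<in> S" "n \<noteq> l" using two by (cases "l = x") (auto simp: S_def)
    have "n - l \<in> S" "n - l \<noteq> n" using diff[OF n(1) l n(2)] l S0 by auto
    then show ?thesis using diff[of "n - l" n] n by simp
  qed
  have "u - v \<in> insert 0 S" if "u \<in> insert 0 S" "v \<in> insert 0 S" for u v
    using that diff neg by (cases "u = v") auto
  moreover have "x \<in> insert 0 S" "x \<noteq> 0" using two b0 by (auto simp: S_def)
  ultimately obtain N where N: "N \<ge> 1" "\<And>y. y \<in> insert 0 S \<longleftrightarrow> int N dvd y"
    using int_subgroup_generator[of "insert 0 S" x] by blast
  show ?thesis
  proof (rule that[OF N(1)])
    fix l show "b l \<noteq> 0 \<longleftrightarrow> l \<noteq> 0 \<and> int N dvd l"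
      using N(2)[of l] S0 by (auto simp: S_def)
  qed
qed

text \<open>
  The identity for \<open>l = N n\<close> and \<open>m = N m'\<close> has a common factor \<open>N\<close>; after cancelling it and dividing by
  the three values of \<open>b\<close>, it is the recurrence of \<open>affine_of_recurrence\<close> for the reciprocals \<open>e\<close>.
  The third case has \<open>\<alpha> = b\<^sub>N\<close> and \<open>\<beta> = b\<^sub>2\<^sub>N\<close>, and the inequality is \<open>\<alpha> \<beta> e\<^sub>n\<^sub>+\<^sub>1 \<noteq> 0\<close>.
\<close>

lemma prelie_sequence_cases:
  fixes b :: "int \<Rightarrow> 'k::field_char_0"
  assumes b: "prelie_sequence b" and b0: "b 0 = 0"
  obtains (zero) "b = (\<lambda>_. 0)"
    | (single) k0 a where "k0 \<noteq> 0" "a \<noteq> 0" "b = (\<lambda>l. if l = k0 then a else 0)"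
    | (affine) N \<alpha> \<beta> where "N \<ge> 1" "\<alpha> \<noteq> 0" "\<beta> \<noteq> 0"
        "\<And>n. n \<noteq> -1 \<Longrightarrow> of_int n * \<alpha> - of_int (n - 1) * \<beta> \<noteq> 0"
        "\<And>l. b l = (if l \<noteq> 0 \<and> int N dvd l then
          \<alpha> * \<beta> / ((of_int l / of_nat N - 1) * \<alpha> - (of_int l / of_nat N - 2) * \<beta>) else 0)"
proof (cases "\<exists>x y. x \<noteq> y \<and> b x \<noteq> 0 \<and> b y \<noteq> 0")
  case False
  show ?thesis
  proof (cases "\<exists>k0. b k0 \<noteq> 0")
    case True
    then obtain k0 where "b k0 \<noteq> 0" by blast
    moreover from this False have "b = (\<lambda>l. if l = k0 then b k0 else 0)" by (intro ext) auto
    ultimately show ?thesis using single[of k0 "b k0"] b0 by metis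
  qed (use zero in auto)
next
  case True
  then obtain N where N: "N \<ge> 1" "\<And>l. b l \<noteq> 0 \<longleftrightarrow> l \<noteq> 0 \<and> int N dvd l"
    using prelie_sequence_support[OF b b0] by metis
  define e where "e n = inverse (b (int N * n))" for n
  have bnz: "b (int N * n) \<noteq> 0" if "n \<noteq> 0" for n
    using N that by simp
  have rec: "of_int n * e n - of_int m * e m = of_int (n - m) * e (n + m)"
    if "n \<noteq> 0" "m \<noteq> 0" "n + m \<noteq> 0" for n m
  proof -
    have "(of_nat N * of_int n * b (int N * m) - of_nat N * of_int m * b (int N * n)) * b (int N * (n + m)) =
        (of_nat N * of_int n - of_nat N * of_int m) * b (int N * n) * b (int N * m)"
      using b[unfolded prelie_sequence_def, rule_format, of "int N * n" "int N * m"] that N(1)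
      by (simp flip: distrib_left)
    then have "of_nat N * ((of_int n * b (int N * m) - of_int m * b (int N * n)) * b (int N * (n + m)) -
        of_int (n - m) * b (int N * n) * b (int N * m)) = 0"
      by (simp add: algebra_simps)
    then have "(of_int n * b (int N * m) - of_int m * b (int N * n)) * b (int N * (n + m)) =
        of_int (n - m) * b (int N * n) * b (int N * m)"
      using N(1) by simp
    then show ?thesis
      using bnz[OF that(1)] bnz[OF that(2)] bnz[OF that(3)] by (simp add: e_def field_simps)
  qed
  define \<alpha> \<beta> where ab: "\<alpha> = b (int N * 1)" "\<beta> = b (int N * 2)"
  have nz: "\<alpha> \<noteq> 0" "\<beta> \<noteq> 0" unfolding ab by (rule bnz; simp)+
  have inv: "inverse (b (int N * n)) * (\<alpha> * \<beta>) = of_int (n - 1) * \<alpha> - of_int (n - 2) * \<beta>"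
    if "n \<noteq> 0" for n
  proof -
    have "inverse (b (int N * n)) = of_int (n - 1) * inverse \<beta> - of_int (n - 2) * inverse \<alpha>"
      using affine_of_recurrence[OF rec that] by (simp add: e_def ab)
    then show ?thesis using nz by (simp add: field_simps)
  qed
  show ?thesis
  proof (rule affine[OF N(1) nz])
    fix n :: int assume "n \<noteq> -1"
    then have "inverse (b (int N * (n + 1))) * (\<alpha> * \<beta>) \<noteq> 0"
      using bnz[of "n + 1"] nz by simp
    moreover have "n + 1 - 1 = n" "n + 1 - 2 = n - 1" by simp_all
    ultimately show "of_int n * \<alpha> - of_int (n - 1) * \<beta> \<noteq> 0"
      using inv[of "n + 1"] \<open>n \<noteq> -1\<close> by (metis add_eq_0_iff2)
  next
    fix l
    show "b l = (if l \<noteq> 0 \<and> int N dvd l then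
      \<alpha> * \<beta> / ((of_int l / of_nat N - 1) * \<alpha> - (of_int l / of_nat N - 2) * \<beta>) else 0)"
    proof (cases "l \<noteq> 0 \<and> int N dvd l")
      case True
      then obtain n where n: "l = int N * n" "n \<noteq> 0" by (auto elim: dvdE)
      have "b l = \<alpha> * \<beta> / (of_int (n - 1) * \<alpha> - of_int (n - 2) * \<beta>)"
        unfolding n(1) inv[OF n(2), symmetric] using bnz[OF n(2)] nz by (simp add: field_simps)
      moreover have "of_int l / of_nat N = (of_int n :: 'k)" using N(1) by (simp add: n)
      ultimately show ?thesis using True by simp
    qed (use N in auto)
  qed
qed

section \<open>Products by weighted derivations\<close>

text \<open>
  For fixed \<open>l\<close>, the map \<open>X\<^sup>k \<mapsto> k (X\<^sup>k - X\<^sup>k\<^sup>+\<^sup>l)\<close> is the derivation \<open>(1 - X\<^sup>l) X d/dX\<close>. Right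
  multiplication by \<open>X\<^sup>l\<close> is its multiple by the weight \<open>b\<^sub>l\<close>.
\<close>

definition weighted_derivations ::
  "(int \<Rightarrow> 'k::field) \<Rightarrow> ('k laurent \<Rightarrow> 'k laurent \<Rightarrow> 'k laurent) \<Rightarrow> bool"
  where "weighted_derivations b p \<longleftrightarrow>
    (\<forall>k l. p (X_pow k) (X_pow l) = fscale (b l * of_int k) (X_pow k - X_pow (k + l)))"

lemma X_pow_mult_cancel: "f * X_pow n = g * X_pow n \<longleftrightarrow> f = (g :: 'k::field laurent)"
proof -
  have "h = (h * X_pow n) * X_pow (- n)" for h :: "'k laurent"
    by (simp add: mult.assoc X_pow_0 flip: X_pow_add)
  then show ?thesis by metis
qed

text \<open>
  A derivation of the Laurent polynomials is determined by its value at \<open>X\<close>: by the Leibniz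
  rule the claim for \<open>k\<close> and the claim for \<open>k + 1\<close> imply each other, since \<open>X\<close> is invertible.
\<close>

lemma derivation_X_pow:
  fixes d :: "'k::field laurent \<Rightarrow> 'k laurent"
  assumes leibniz: "\<And>f g. d (f * g) = d f * g + f * d g"
    and X: "d (X_pow 1) = fscale c (X_pow 1 - X_pow (1 + l))"
  shows "d (X_pow k) = fscale (c * of_int k) (X_pow k - X_pow (k + l))"
proof -
  let ?t = "\<lambda>k. fscale (c * of_int k) (X_pow k - X_pow (k + l)) :: 'k laurent"
  have t: "?t (k + 1) = ?t k * X_pow 1 + X_pow k * fscale c (X_pow 1 - X_pow (1 + l))" for k
    by (simp add: fscale_mult right_diff_distrib left_diff_distrib add_ac flip: X_pow_add)
      (rule poly_mapping_eqI, simp add: lookup_add lookup_minus algebra_simps)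
  have d: "d (X_pow (k + 1)) = d (X_pow k) * X_pow 1 + X_pow k * fscale c (X_pow 1 - X_pow (1 + l))" for k
    using leibniz[of "X_pow k" "X_pow 1"] by (simp add: X_pow_add X)
  have step: "d (X_pow (k + 1)) = ?t (k + 1) \<longleftrightarrow> d (X_pow k) = ?t k" for k
    unfolding d t add_right_cancel X_pow_mult_cancel ..
  show ?thesis
  proof (induction k rule: int_induct[where k = 0])
    case base
    have "d 1 = d 1 + d 1"
      using leibniz[of 1 1] by (simp only: mult_1_left mult_1_right)
    then have "d 1 = 0" by (metis add_cancel_left_right)
    then show ?case by (simp add: X_pow_0 fscale_eq_mult)
  next
    case (step1 i)
    then show ?case using step[of i] by blast
  next
    case (step2 i)
    then show ?case using step[of "i - 1"] by simp
  qed
qed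

text \<open>
  In \<open>(X\<^sup>k \<bullet> X\<^sup>l) \<bullet> X\<^sup>m - X\<^sup>k \<bullet> (X\<^sup>l \<bullet> X\<^sup>m)\<close> the terms in \<open>X\<^sup>k\<^sup>+\<^sup>l\<close> and \<open>X\<^sup>k\<^sup>+\<^sup>m\<close> are symmetric in \<open>l\<close> and \<open>m\<close>.
  So they cancel, and the failure of the pre-Lie identity is a multiple of
  \<open>X\<^sup>k - X\<^sup>k\<^sup>+\<^sup>l\<^sup>+\<^sup>m\<close>.
\<close>

lemma prelie_X_pow:
  assumes p: "bilinear_map fscale fscale p" and b: "weighted_derivations b p"
  shows "p (p (X_pow k) (X_pow l)) (X_pow m) - p (X_pow k) (p (X_pow l) (X_pow m)) -
      (p (p (X_pow k) (X_pow m)) (X_pow l) - p (X_pow k) (p (X_pow m) (X_pow l))) =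
    fscale (of_int k * ((of_int l * b m - of_int m * b l) * b (l + m) - of_int (l - m) * b l * b m))
      (X_pow k - X_pow (k + l + m))"
proof -
  have p_diff: "p (f - g) h = p f h - p g h" "p h (f - g) = p h f - p h g" for f g h
    using p unfolding bilinear_map_iff by (metis add_diff_cancel_right' diff_add_cancel)+
  have p_scale: "p (fscale c f) g = fscale c (p f g)" "p f (fscale c g) = fscale c (p f g)" for c f g
    using p by (simp_all add: bilinear_map_iff)
  have b: "p (X_pow k) (X_pow l) = fscale (b l * of_int k) (X_pow k - X_pow (k + l))" for k l
    using b by (simp add: weighted_derivations_def)
  have eq: "m + l = l + m" "k + m + l = k + l + m" "k + (l + m) = k + l + m" by simp_all
  show ?thesis
    unfolding b p_diff p_scale eq
    by (rule poly_mapping_eqI) (simp add: lookup_add lookup_minus algebra_simps)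
qed

lemma leibniz_if_weighted:
  assumes p: "bilinear_map fscale fscale p" and b: "weighted_derivations b p"
  shows "p (f * g) h = p f h * g + f * p g h"
proof -
  note lin = p[unfolded bilinear_map_iff] fscale_mult fscale_add
  show ?thesis
  proof (induction f rule: laurent_induct)
    case (X_pow k)
    show ?case
    proof (induction g rule: laurent_induct)
      case (X_pow l)
      show ?case
      proof (induction h rule: laurent_induct)
        case (X_pow m)
        show ?case
          using b by (simp add: weighted_derivations_def fscale_mult right_diff_distrib
              left_diff_distrib add_ac flip: X_pow_add)
            (rule poly_mapping_eqI, simp add: lookup_add lookup_minus algebra_simps)
      qed (simp_all add: lin algebra_simps)
    qed (simp_all add: lin algebra_simps)
  qed (simp_all add: lin algebra_simps)
qed

lemma prelie_if_prelie_X_pow: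
  assumes p: "bilinear_map fscale fscale p"
    and X: "\<And>k l m. p (p (X_pow k) (X_pow l)) (X_pow m) - p (X_pow k) (p (X_pow l) (X_pow m)) =
      p (p (X_pow k) (X_pow m)) (X_pow l) - p (X_pow k) (p (X_pow m) (X_pow l))"
  shows "p (p f g) h - p f (p g h) = p (p f h) g - p f (p h (g :: 'k::field laurent))"
proof -
  have diff: "fscale c (f - g) = fscale c f - fscale c g" for c and f g :: "'k laurent"
    by (rule poly_mapping_eqI) (simp add: lookup_minus algebra_simps)
  have lin: "p (f + g) h = p f h + p g h" "p f (g + h) = p f g + p f h"
    "p (fscale c f) g = fscale c (p f g)" "p f (fscale c g) = fscale c (p f g)" for c f g h
    using p by (simp_all add: bilinear_map_iff)
  show ?thesis
  proof (induction f rule: laurent_induct)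
    case (X_pow k)
    show ?case
    proof (induction g rule: laurent_induct)
      case (X_pow l)
      show ?case
      proof (induction h rule: laurent_induct)
        case (X_pow m)
        show ?case by (rule X)
      next
        case (add f g)
        then show ?case by (simp add: lin add_diff_add)
      qed (simp add: lin flip: diff)
    next
      case (add f g)
      then show ?case by (simp add: lin add_diff_add)
    qed (simp add: lin flip: diff)
  next
    case (add f g)
    then show ?case by (simp add: lin add_diff_add)
  qed (simp add: lin flip: diff)
qed

section \<open>The coproduct of Laurent polynomials\<close>

locale laurent_coproduct = tensor_algebra_hom fscale "(*)" 1 \<Delta>
  for \<Delta> :: "'k::field laurent \<Rightarrow> ('k laurent, 'k) tensor2" +
  assumes coproduct_X: "tensor_eq fscale (\<Delta> (X_pow 1)) (tensor (X_pow 1) (X_pow 1))"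
begin

lemma flift_coproduct_mult:
  assumes s: "vector_space s" and f: "bilinear_map fscale s f"
  shows "flift s (\<lambda>(x, y). f x y) (\<Delta> (a * b)) =
    flift s (\<lambda>(x, y). flift s (\<lambda>(u, v). f (x * u) (y * v)) (\<Delta> b)) (\<Delta> a)"
proof -
  define L where "L = flift s (\<lambda>(x, y). f x y)"
  have L: "Vector_Spaces.linear fscale s L"
    unfolding L_def by (rule linear_flift[OF s])
  have L_tensor: "L (tensor x y) = f x y" for x y
    unfolding L_def by (rule flift_tensor[OF s])
  have "L (\<Delta> (a * b)) = L (tensor_mult (*) (\<Delta> a) (\<Delta> b))"
    unfolding L_def by (rule flift_tensor_eq[OF s f hom_mult])
  also have "\<dots> = flift s (\<lambda>(x, y). flift s (\<lambda>(u, v). f (x * u) (y * v)) (\<Delta> b)) (\<Delta> a)"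
    by (simp add: tensor_mult_def linear_apply_flift[OF L] case_prod_unfold L_tensor)
  finally show ?thesis by (simp add: L_def)
qed

definition grouplike :: "'k laurent \<Rightarrow> bool"
  where "grouplike g \<longleftrightarrow> tensor_eq fscale (\<Delta> g) (tensor g g)"

lemma flift_grouplike:
  assumes "grouplike g" "vector_space s" "bilinear_map fscale s f"
  shows "flift s (\<lambda>(x, y). f x y) (\<Delta> g) = f g g"
  using flift_tensor_eq[OF assms(2,3) assms(1)[unfolded grouplike_def]]
  by (simp add: flift_tensor[OF assms(2)])

lemma grouplikeI:
  assumes "\<And>B. bilinear_map fscale (*) B \<Longrightarrow> flift (*) (\<lambda>(x, y). B x y) (\<Delta> g) = B g g"
  shows "grouplike g"
  unfolding grouplike_def tensor_eq_iff_forms[OF vector_space_fscale]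
  using assms by (simp add: flift_tensor[OF vector_space_mult])

text \<open>
  Multiplicativity of \<open>\<Delta>\<close> in the case where the left factor is grouplike: \<open>\<Delta> (g h) = (g \<otimes> g) \<Delta> h\<close>.
\<close>

lemma flift_grouplike_mult:
  assumes "grouplike g" "vector_space s" "bilinear_map fscale s f"
  shows "flift s (\<lambda>(x, y). f x y) (\<Delta> (g * h)) = flift s (\<lambda>(u, v). f (g * u) (g * v)) (\<Delta> h)"
proof -
  have "bilinear_map fscale s (\<lambda>x y. flift s (\<lambda>i. case i of (u, v) \<Rightarrow> f (x * u) (y * v)) (\<Delta> h))"
    by (rule bilinear_flift[OF assms(2)]) (simp add: split_def bilinear_translate' assms)
  from flift_grouplike[OF assms(1,2) this] show ?thesis
    by (simp add: flift_coproduct_mult assms)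
qed

lemma grouplike_mult:
  assumes "grouplike g" "grouplike h"
  shows "grouplike (g * h)"
proof (rule grouplikeI)
  fix B :: "'k laurent \<Rightarrow> 'k laurent \<Rightarrow> 'k" assume B: "bilinear_map fscale (*) B"
  show "flift (*) (\<lambda>(x, y). B x y) (\<Delta> (g * h)) = B (g * h) (g * h)"
    by (simp add: flift_grouplike_mult[OF assms(1) vector_space_mult B]
        flift_grouplike[OF assms(2) vector_space_mult bilinear_translate[OF B]])
qed

lemma grouplike_one: "grouplike 1"
  unfolding grouplike_def by (rule hom_unit)

text \<open>
  Multiplying \<open>1 \<otimes> 1 = \<Delta> (g h) = (g \<otimes> g) \<Delta> h\<close> by \<open>h \<otimes> h\<close> gives \<open>h \<otimes> h = \<Delta> h\<close>. This step reaches the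
  negative powers of \<open>X\<close>, on which \<open>\<Delta>\<close> is not prescribed.
\<close>

lemma grouplike_inverse:
  assumes g: "grouplike g" and gh: "g * h = 1"
  shows "grouplike h"
proof (rule grouplikeI)
  fix B :: "'k laurent \<Rightarrow> 'k laurent \<Rightarrow> 'k" assume B: "bilinear_map fscale (*) B"
  note B' = bilinear_translate[OF B, of h h]
  have hg: "h * (g * u) = u" for u
    using gh by (metis mult.assoc mult.commute mult.left_neutral)
  have "B h h = flift (*) (\<lambda>(x, y). B (h * x) (h * y)) (\<Delta> (g * h))"
    using flift_grouplike[OF grouplike_one vector_space_mult B'] by (simp add: gh)
  also have "\<dots> = flift (*) (\<lambda>(u, v). B u v) (\<Delta> h)"
    using flift_grouplike_mult[OF g vector_space_mult B', of h] by (simp add: hg)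
  finally show "flift (*) (\<lambda>(x, y). B x y) (\<Delta> h) = B h h" by simp
qed

lemma grouplike_X_pow: "grouplike (X_pow n)"
proof -
  have nat: "grouplike (X_pow (int k))" for k
  proof (induction k)
    case 0
    show ?case by (simp add: X_pow_0 grouplike_one)
  next
    case (Suc k)
    have "grouplike (X_pow 1)" using coproduct_X by (simp add: grouplike_def)
    then show ?case using grouplike_mult[OF _ Suc] by (simp add: X_pow_add)
  qed
  show ?thesis
  proof (cases "n \<ge> 0")
    case True
    then show ?thesis using nat[of "nat n"] by simp
  next
    case False
    then have "grouplike (X_pow (- n))" using nat[of "nat (- n)"] by simp
    then show ?thesis
      by (rule grouplike_inverse) (simp add: X_pow_0 flip: X_pow_add)
  qed
qed

text \<open>
  Under bilinear maps, \<open>\<Delta> a\<close> behaves as \<open>\<Sum>\<^sub>n a\<^sub>n X\<^sup>n \<otimes> X\<^sup>n\<close>, whatever representative was chosen.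
\<close>

lemma flift_coproduct:
  assumes s: "vector_space s" and f: "bilinear_map fscale s f"
  shows "flift s (\<lambda>(x, y). f x y) (\<Delta> a) = flift s (\<lambda>n. f (X_pow n) (X_pow n)) a"
proof (induction a rule: laurent_induct)
  case (X_pow n)
  show ?case
    by (simp add: flift_grouplike[OF grouplike_X_pow s f] flift_X_pow[OF s])
next
  case (add a b)
  then show ?case
    using flift_tensor_eq[OF s f hom_add[of a b]] by (simp add: flift_add[OF s])
next
  case (scale c a)
  then show ?case
    using flift_tensor_eq[OF s f hom_scale[of c a]] by (simp add: flift_fscale[OF s])
qed

text \<open>
  The counit is the sum of the coefficients, so \<open>\<epsilon> (X\<^sup>n) = 1\<close>. Both sides of coassociativity are
  \<open>\<Sum>\<^sub>n a\<^sub>n X\<^sup>n \<otimes> X\<^sup>n \<otimes> X\<^sup>n\<close>.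
\<close>

lemma comm_bialgebra_laurent: "comm_bialgebra fscale (*) 1 \<Delta> (flift (*) (\<lambda>_. 1))"
proof -
  let ?\<epsilon> = "flift (*) (\<lambda>_. 1) :: 'k laurent \<Rightarrow> 'k"
  note K = vector_space_mult and L = vector_space_fscale
  have bil: "bilinear_map fscale fscale (\<lambda>x y. fscale (?\<epsilon> x) (y :: 'k laurent))"
    by (auto simp: bilinear_map_iff L flift_add[OF K] flift_fscale[OF K] intro!: poly_mapping_eqI)
      (simp_all add: lookup_add algebra_simps)
  have counit: "flift fscale (\<lambda>(x, y). fscale (?\<epsilon> x) y) (\<Delta> a) = a"
    "flift fscale (\<lambda>(x, y). fscale (?\<epsilon> y) x) (\<Delta> a) = a" for a :: "'k laurent"
  proof -
    have bil': "bilinear_map fscale fscale (\<lambda>x y. fscale (?\<epsilon> y) (x :: 'k laurent))"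
      using bil by (auto simp: bilinear_map_iff)
    have "fscale 1 f = f" for f :: "'k laurent" by (rule poly_mapping_eqI) simp
    then have "flift fscale (\<lambda>n. fscale (?\<epsilon> (X_pow n)) (X_pow n)) a = a"
      using flift_of_linear[of fscale "\<lambda>a. a" a]
      by (simp add: flift_X_pow[OF K] X_pow_def[symmetric] Vector_Spaces.linear_iff L)
    then show "flift fscale (\<lambda>(x, y). fscale (?\<epsilon> x) y) (\<Delta> a) = a"
      "flift fscale (\<lambda>(x, y). fscale (?\<epsilon> y) x) (\<Delta> a) = a"
      by (simp_all add: flift_coproduct[OF L bil] flift_coproduct[OF L bil'])
  qed
  have mult: "?\<epsilon> (a * b) = ?\<epsilon> a * ?\<epsilon> b" for a b :: "'k laurent"
  proof (induction a rule: laurent_induct)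
    case (X_pow n)
    show ?case
      by (induction b rule: laurent_induct)
        (simp_all add: flift_X_pow[OF K] flift_add[OF K] flift_fscale[OF K] distrib_left fscale_mult
          flip: X_pow_add)
  qed (simp_all add: flift_add[OF K] flift_fscale[OF K] distrib_right fscale_mult mult.assoc)
  have coassoc: "tensor3_eq fscale
      (flift fscale (\<lambda>(x, y). flift fscale (\<lambda>(u, v). tensor3 u v y) (\<Delta> x)) (\<Delta> a))
      (flift fscale (\<lambda>(x, y). flift fscale (\<lambda>(u, v). tensor3 x u v) (\<Delta> y)) (\<Delta> a))"
    for a :: "'k laurent"
  proof (rule tensor3_eqI_forms[OF L])
    fix B :: "'k laurent \<Rightarrow> 'k laurent \<Rightarrow> 'k laurent \<Rightarrow> 'k"
    assume B: "\<And>z. bilinear_map fscale (*) (\<lambda>x y. B x y z)" "\<And>x. bilinear_map fscale (*) (B x)"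
    define T where "T = flift (*) (\<lambda>(x, y, z). B x y z)"
    have T: "Vector_Spaces.linear fscale (*) T"
      unfolding T_def by (rule linear_flift[OF K])
    have T_tensor: "T (tensor3 x y z) = B x y z" for x y z
      by (simp add: T_def tensor3_def flift_single[OF K])
    have B1: "bilinear_map fscale (*) (\<lambda>x y. flift (*) (\<lambda>n. B (X_pow n) (X_pow n) y) x)"
      and B2: "bilinear_map fscale (*) (\<lambda>x y. flift (*) (\<lambda>n. B x (X_pow n) (X_pow n)) y)"
      using B by (simp_all add: bilinear_map_iff flift_add[OF K] flift_fscale[OF K]
          flift_add_fun[OF K] flift_scale_fun[OF K])
    have "T (flift fscale (\<lambda>(x, y). flift fscale (\<lambda>(u, v). tensor3 u v y) (\<Delta> x)) (\<Delta> a)) =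
        flift (*) (\<lambda>(x, y). flift (*) (\<lambda>(u, v). B u v y) (\<Delta> x)) (\<Delta> a)"
      by (simp add: linear_apply_flift[OF T] case_prod_unfold T_tensor)
    also have "\<dots> = flift (*) (\<lambda>n. B (X_pow n) (X_pow n) (X_pow n)) a"
      by (simp add: flift_coproduct[OF K B(1)] flift_coproduct[OF K B1] flift_X_pow[OF K])
    also have "\<dots> = flift (*) (\<lambda>(x, y). flift (*) (\<lambda>(u, v). B x u v) (\<Delta> y)) (\<Delta> a)"
      by (simp add: flift_coproduct[OF K B(2)] flift_coproduct[OF K B2] flift_X_pow[OF K])
    also have "\<dots> = T (flift fscale (\<lambda>(x, y). flift fscale (\<lambda>(u, v). tensor3 x u v) (\<Delta> y)) (\<Delta> a))"
      by (simp add: linear_apply_flift[OF T] case_prod_unfold T_tensor)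
    finally show "T (flift fscale (\<lambda>(x, y). flift fscale (\<lambda>(u, v). tensor3 u v y) (\<Delta> x)) (\<Delta> a)) =
        T (flift fscale (\<lambda>(x, y). flift fscale (\<lambda>(u, v). tensor3 x u v) (\<Delta> y)) (\<Delta> a))"
      by (simp only: T_def)
  qed
  show ?thesis
    by (intro comm_bialgebra.intro comm_bialgebra_axioms.intro comm_assoc_algebra_laurent
        tensor_algebra_hom_axioms coassoc counit mult linear_flift[OF K])
      (simp_all add: flift_X_pow[OF K] flip: X_pow_0)
qed

subsection \<open>Compatibility of a product with the coproduct\<close>

text \<open>
  With \<open>\<Delta>\<close> evaluated by \<open>flift_coproduct\<close>, compatibility becomes an identity of scalars that is
  linear in \<open>a\<close> and in \<open>b\<close>.
\<close>

lemma prelie_coproduct_iff_forms: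
  assumes p: "bilinear_map fscale fscale p"
  shows "tensor_eq fscale (\<Delta> (p a b))
      (flift fscale (\<lambda>(x, y). tensor x (p y b)) (\<Delta> a) +
       flift fscale (\<lambda>(x, y). flift fscale (\<lambda>(u, v). tensor (p x u) (y * v)) (\<Delta> b)) (\<Delta> a))
    \<longleftrightarrow> (\<forall>B. bilinear_map fscale (*) B \<longrightarrow>
      flift (*) (\<lambda>n. B (X_pow n) (X_pow n)) (p a b) =
      flift (*) (\<lambda>n. B (X_pow n) (p (X_pow n) b)) a +
      flift (*) (\<lambda>m. flift (*) (\<lambda>n. B (p (X_pow m) (X_pow n)) (X_pow (m + n))) b) a)"
    (is "tensor_eq fscale _ (?u + ?v) \<longleftrightarrow> _")
proof -
  note K = vector_space_mult and L = vector_space_fscale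
  have "flift (*) (\<lambda>(x, y). B x y) (\<Delta> (p a b)) = flift (*) (\<lambda>n. B (X_pow n) (X_pow n)) (p a b)"
    "flift (*) (\<lambda>(x, y). B x y) (?u + ?v) =
      flift (*) (\<lambda>n. B (X_pow n) (p (X_pow n) b)) a +
      flift (*) (\<lambda>m. flift (*) (\<lambda>n. B (p (X_pow m) (X_pow n)) (X_pow (m + n))) b) a"
    if B: "bilinear_map fscale (*) B" for B :: "'k laurent \<Rightarrow> 'k laurent \<Rightarrow> 'k"
  proof -
    show "flift (*) (\<lambda>(x, y). B x y) (\<Delta> (p a b)) = flift (*) (\<lambda>n. B (X_pow n) (X_pow n)) (p a b)"
      by (rule flift_coproduct[OF K B])
    define T where "T = flift (*) (\<lambda>(x, y). B x y)"
    have T: "Vector_Spaces.linear fscale (*) T"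
      unfolding T_def by (rule linear_flift[OF K])
    have T_tensor: "T (tensor x y) = B x y" for x y
      unfolding T_def by (rule flift_tensor[OF K])
    have B1: "bilinear_map fscale (*) (\<lambda>x y. B x (p y b))"
      and B2: "bilinear_map fscale (*) (\<lambda>u v. B (p x u) (y * v))"
      and B3: "bilinear_map fscale (*) (\<lambda>x y. B (p x u) (y * v))" for x y u v
      using B p by (simp_all add: bilinear_map_iff fscale_mult distrib_left distrib_right)
    note B4 = bilinear_flift[OF K B3, of X_pow X_pow]
    have "T (?u + ?v) = T ?u + T ?v"
      by (simp add: T_def flift_add[OF K])
    also have "T ?u = flift (*) (\<lambda>(x, y). B x (p y b)) (\<Delta> a)"
      by (simp add: linear_apply_flift[OF T] case_prod_unfold T_tensor)
    also have "T ?v = flift (*) (\<lambda>(x, y). flift (*) (\<lambda>(u, v). B (p x u) (y * v)) (\<Delta> b)) (\<Delta> a)"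
      by (simp add: linear_apply_flift[OF T] case_prod_unfold T_tensor)
    finally show "T (?u + ?v) =
      flift (*) (\<lambda>n. B (X_pow n) (p (X_pow n) b)) a +
      flift (*) (\<lambda>m. flift (*) (\<lambda>n. B (p (X_pow m) (X_pow n)) (X_pow (m + n))) b) a"
      by (simp add: flift_coproduct[OF K B1] flift_coproduct[OF K B2] flift_coproduct[OF K B4] X_pow_add)
  qed
  then show ?thesis by (simp add: tensor_eq_iff_forms[OF L])
qed

text \<open>
  Let \<open>P = X\<^sup>k \<bullet> X\<^sup>l\<close>. The coefficients at \<open>X\<^sup>i \<otimes> X\<^sup>j\<close> in \<open>\<Delta> P = X\<^sup>k \<otimes> P + P \<otimes> X\<^sup>k\<^sup>+\<^sup>l\<close> give
  \<open>\<delta>\<^sub>i\<^sub>j P\<^sub>i = \<delta>\<^sub>i\<^sub>k P\<^sub>j + \<delta>\<^sub>j\<^sub>,\<^sub>k\<^sub>+\<^sub>l P\<^sub>i\<close>. The diagonal kills all coefficients of \<open>P\<close> except those at \<open>k\<close> and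
  \<open>k + l\<close>, and the position \<open>(k, k + l)\<close> says that these two are opposite. For \<open>l = 0\<close> the position
  \<open>(k, k)\<close> says \<open>P\<^sub>k = 2 P\<^sub>k\<close>, so that \<open>P = 0\<close>.
\<close>

lemma prelie_coproduct_X_pow_shape:
  assumes p: "bilinear_map fscale fscale p"
    and co: "tensor_eq fscale (\<Delta> (p (X_pow k) (X_pow l)))
      (flift fscale (\<lambda>(x, y). tensor x (p y (X_pow l))) (\<Delta> (X_pow k)) +
       flift fscale (\<lambda>(x, y). flift fscale (\<lambda>(u, v). tensor (p x u) (y * v)) (\<Delta> (X_pow l))) (\<Delta> (X_pow k)))"
  shows "p (X_pow k) (X_pow l) =
    fscale (Poly_Mapping.lookup (p (X_pow k) (X_pow l)) k) (X_pow k - X_pow (k + l))"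
proof -
  note K = vector_space_mult
  define P where "P = Poly_Mapping.lookup (p (X_pow k) (X_pow l))"
  have P: "(if i = j then P i else 0) = (if i = k then P j else 0) + (if j = k + l then P i else 0)" for i j
  proof -
    let ?B = "\<lambda>x y. Poly_Mapping.lookup x i * Poly_Mapping.lookup y j"
    have B: "bilinear_map fscale (*) ?B"
      by (simp add: bilinear_map_iff vector_space_fscale K lookup_add algebra_simps)
    have lin: "Vector_Spaces.linear fscale (*) (\<lambda>f. if i = j then Poly_Mapping.lookup f i else 0)"
      by (simp add: Vector_Spaces.linear_iff vector_space_fscale K lookup_add)
    have "flift (*) (\<lambda>n. ?B (X_pow n) (X_pow n)) (p (X_pow k) (X_pow l)) =
        flift (*) (\<lambda>n. if i = j then Poly_Mapping.lookup (Poly_Mapping.single n 1) i else 0)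
          (p (X_pow k) (X_pow l))"
      by (rule flift_cong) (auto simp: lookup_X_pow lookup_single when_def)
    also have "\<dots> = (if i = j then P i else 0)"
      unfolding P_def by (rule flift_of_linear[OF lin])
    finally show ?thesis
      using co[unfolded prelie_coproduct_iff_forms[OF p], rule_format, OF B]
      by (simp add: flift_X_pow[OF K] lookup_X_pow P_def)
  qed
  show ?thesis
  proof (rule poly_mapping_eqI)
    fix i
    show "Poly_Mapping.lookup (p (X_pow k) (X_pow l)) i = Poly_Mapping.lookup
      (fscale (Poly_Mapping.lookup (p (X_pow k) (X_pow l)) k) (X_pow k - X_pow (k + l))) i"
      using P[of i i] P[of k "k + l"]
      by (auto simp: lookup_minus lookup_X_pow add_eq_0_iff simp flip: P_def split: if_splits)
  qed
qed

text \<open>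
  By bilinearity this is the case of powers, where it says that for \<open>u = X\<^sup>k\<close> and \<open>v = X\<^sup>k\<^sup>+\<^sup>l\<close> one has
  \<open>u \<otimes> u - v \<otimes> v = u \<otimes> (u - v) + (u - v) \<otimes> v\<close>.
\<close>

lemma prelie_coproduct_if_weighted:
  assumes p: "bilinear_map fscale fscale p" and b: "weighted_derivations b p"
  shows "tensor_eq fscale (\<Delta> (p f g))
      (flift fscale (\<lambda>(x, y). tensor x (p y g)) (\<Delta> f) +
       flift fscale (\<lambda>(x, y). flift fscale (\<lambda>(u, v). tensor (p x u) (y * v)) (\<Delta> g)) (\<Delta> f))"
  unfolding prelie_coproduct_iff_forms[OF p]
proof (intro allI impI)
  fix B :: "'k laurent \<Rightarrow> 'k laurent \<Rightarrow> 'k" assume B: "bilinear_map fscale (*) B"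
  note K = vector_space_mult
  note lin = p[unfolded bilinear_map_iff] B[unfolded bilinear_map_iff] flift_add[OF K] flift_fscale[OF K]
    flift_add_fun[OF K] flift_scale_fun[OF K]
  show "flift (*) (\<lambda>n. B (X_pow n) (X_pow n)) (p f g) =
      flift (*) (\<lambda>n. B (X_pow n) (p (X_pow n) g)) f +
      flift (*) (\<lambda>m. flift (*) (\<lambda>n. B (p (X_pow m) (X_pow n)) (X_pow (m + n))) g) f"
  proof (induction f rule: laurent_induct)
    case (X_pow k)
    show ?case
    proof (induction g rule: laurent_induct)
      case (X_pow l)
      let ?c = "b l * of_int k" and ?u = "X_pow k :: 'k laurent" and ?v = "X_pow (k + l) :: 'k laurent"
      have diff: "L (X_pow k - X_pow (k + l)) = L (X_pow k) - L (X_pow (k + l))"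
        if "\<And>f g. L (f + g) = L f + (L g :: 'k)" for L :: "'k laurent \<Rightarrow> 'k"
        using that by (metis add_diff_cancel_right' diff_add_cancel)
      have "flift (*) (\<lambda>n. B (X_pow n) (X_pow n)) (?u - ?v) = B ?u ?u - B ?v ?v"
        by (subst diff) (simp_all add: lin flift_X_pow[OF K])
      moreover have "B ?u (?u - ?v) = B ?u ?u - B ?u ?v" by (rule diff) (simp add: lin)
      moreover have "B (?u - ?v) ?v = B ?u ?v - B ?v ?v" by (rule diff) (simp add: lin)
      ultimately show ?case
        using b by (simp add: weighted_derivations_def flift_X_pow[OF K] lin flip: distrib_left)
    qed (simp_all add: lin flift_X_pow[OF K] algebra_simps)
  qed (simp_all add: lin algebra_simps)
qed

text \<open>
  The normalisation \<open>b 0 = 0\<close> is possible because the weight \<open>b\<^sub>0\<close> multiplies \<open>X\<^sup>k - X\<^sup>k = 0\<close>. The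
  sequence is read off from the products \<open>X \<bullet> X\<^sup>l\<close>, which determine all others by the Leibniz rule.
\<close>

theorem com_prelie_bialgebra_iff:
  assumes p: "bilinear_map fscale fscale p"
  shows "com_prelie_bialgebra fscale (*) p \<Delta> \<longleftrightarrow>
    (\<exists>b. b 0 = 0 \<and> prelie_sequence b \<and> weighted_derivations b p)"
proof
  assume "com_prelie_bialgebra fscale (*) p \<Delta>"
  then interpret com_prelie_bialgebra fscale "(*)" p \<Delta> .
  define b where "b l = (if l = 0 then 0 else Poly_Mapping.lookup (p (X_pow 1) (X_pow l)) 1)" for l
  have "p (X_pow 1) (X_pow l) = fscale (b l) (X_pow 1 - X_pow (1 + l))" for l
    using prelie_coproduct_X_pow_shape[OF p prelie_coproduct, of 1 l] by (auto simp: b_def fscale_eq_mult)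
  then have b: "weighted_derivations b p"
    unfolding weighted_derivations_def
    using derivation_X_pow[of "\<lambda>f. p f (X_pow _)"] leibniz by blast
  have "prelie_sequence b"
    unfolding prelie_sequence_def
  proof (intro allI impI)
    fix l m :: int assume lm: "l + m \<noteq> 0"
    let ?c = "(of_int l * b m - of_int m * b l) * b (l + m) - of_int (l - m) * b l * b m"
    have "fscale ?c (X_pow 1 - X_pow (1 + l + m)) = 0"
      using prelie_X_pow[OF p b, of 1 l m] prelie[of "X_pow 1" "X_pow l" "X_pow m"] by simp
    then have "Poly_Mapping.lookup (fscale ?c (X_pow 1 - X_pow (1 + l + m))) 1 = 0"
      by (simp only: lookup_zero)
    then have "?c = 0" using lm by (simp add: lookup_minus lookup_X_pow)
    then show "(of_int l * b m - of_int m * b l) * b (l + m) = of_int (l - m) * b l * b m" by simp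
  qed
  with b show "\<exists>b. b 0 = 0 \<and> prelie_sequence b \<and> weighted_derivations b p"
    by (intro exI[of _ b]) (simp add: b_def)
next
  assume "\<exists>b. b 0 = 0 \<and> prelie_sequence b \<and> weighted_derivations b p"
  then obtain b where seq: "prelie_sequence b" and b: "weighted_derivations b p"
    by blast
  have "p (p (X_pow k) (X_pow l)) (X_pow m) - p (X_pow k) (p (X_pow l) (X_pow m)) =
      p (p (X_pow k) (X_pow m)) (X_pow l) - p (X_pow k) (p (X_pow m) (X_pow l))" for k l m
  proof (cases "l + m = 0")
    case True
    then have "X_pow (k + l + m) = (X_pow k :: 'k laurent)" by (simp add: add.assoc)
    then show ?thesis using prelie_X_pow[OF p b, of k l m] by (simp add: fscale_eq_mult)
  next
    case False
    then have "(of_int l * b m - of_int m * b l) * b (l + m) - of_int (l - m) * b l * b m = 0"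
      using seq by (simp add: prelie_sequence_def)
    then show ?thesis using prelie_X_pow[OF p b, of k l m]
      by (simp only: mult_zero_right) (simp add: fscale_eq_mult)
  qed
  note prelie = prelie_if_prelie_X_pow[OF p this]
  show "com_prelie_bialgebra fscale (*) p \<Delta>"
    by (intro com_prelie_bialgebra.intro com_prelie_bialgebra_axioms.intro com_prelie_algebra.intro
        com_prelie_algebra_axioms.intro comm_assoc_algebra_laurent p prelie
        leibniz_if_weighted[OF p b] prelie_coproduct_if_weighted[OF p b])
      (use comm_bialgebra_laurent in blast)
qed

end

section \<open>Classification of the products\<close>

theorem theorem5p4:
  fixes \<Delta> :: "'k::field_char_0 laurent \<Rightarrow> ('k laurent, 'k) tensor2"
    and bullet :: "'k laurent \<Rightarrow> 'k laurent \<Rightarrow> 'k laurent"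
  assumes "tensor_algebra_hom fscale (*) 1 \<Delta>"
    and "tensor_eq fscale (\<Delta> (X_pow 1)) (tensor (X_pow 1) (X_pow 1))"
    and "bilinear_map fscale fscale bullet"
  shows "com_prelie_bialgebra fscale (*) bullet \<Delta> \<longleftrightarrow>
      (\<forall>f g. bullet f g = 0)
    \<or> (\<exists>(k0::int) (a::'k). k0 \<noteq> 0 \<and> a \<noteq> 0 \<and>
        (\<forall>k l. bullet (X_pow k) (X_pow l) =
          fscale (a * (if l = k0 then 1 else 0) * of_int k) (X_pow k - X_pow (k + l))))
    \<or> (\<exists>(\<alpha>::'k) (\<beta>::'k) (N::nat). \<alpha> \<noteq> 0 \<and> \<beta> \<noteq> 0 \<and>
        (\<forall>n::int. n \<noteq> -1 \<longrightarrow> of_int n * \<alpha> - of_int (n - 1) * \<beta> \<noteq> 0) \<and> N \<ge> 1 \<and>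
        (\<forall>k l. bullet (X_pow k) (X_pow l) =
          (if l = 0 then 0
           else if int N dvd l then
             fscale (\<alpha> * \<beta> /
                 ((of_int l / of_nat N - 1) * \<alpha> - (of_int l / of_nat N - 2) * \<beta>) * of_int k)
               (X_pow k - X_pow (k + l))
           else 0)))"
proof -
  interpret laurent_coproduct \<Delta>
    using assms by (simp add: laurent_coproduct_def laurent_coproduct_axioms_def)
  have weighted: "weighted_derivations b bullet \<longleftrightarrow> (\<forall>k l. bullet (X_pow k) (X_pow l) =
      fscale (b l * of_int k) (X_pow k - X_pow (k + l)))" for b
    by (simp add: weighted_derivations_def)
  have fscale_0: "fscale 0 f = 0" "fscale c (0 :: 'k laurent) = 0" for c and f :: "'k laurent"
    by (rule poly_mapping_eqI, simp)+
  have null: "weighted_derivations (\<lambda>_. 0) bullet \<longleftrightarrow> (\<forall>f g. bullet f g = 0)"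
  proof
    assume X: "weighted_derivations (\<lambda>_. 0) bullet"
    have lin: "bullet (f + g) h = bullet f h + bullet g h" "bullet f (g + h) = bullet f g + bullet f h"
      "bullet (fscale c f) g = fscale c (bullet f g)" "bullet f (fscale c g) = fscale c (bullet f g)"
      for c f g h
      using assms(3) by (simp_all add: bilinear_map_iff)
    have "bullet f g = 0" for f g
    proof (induction f rule: laurent_induct)
      case (X_pow k)
      show ?case
        by (induction g rule: laurent_induct)
          (use X in \<open>simp_all add: weighted fscale_0 lin\<close>)
    qed (simp_all add: lin fscale_0)
    then show "\<forall>f g. bullet f g = 0" by blast
  qed (simp add: weighted fscale_0)
  show ?thesis (is "?bialgebra \<longleftrightarrow> ?zero \<or> ?single \<or> ?affine")
  proof
    assume ?bialgebra
    then obtain b where b: "b 0 = 0" "prelie_sequence b" "weighted_derivations b bullet"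
      using com_prelie_bialgebra_iff[OF assms(3)] by blast
    from b(2,1) show "?zero \<or> ?single \<or> ?affine"
    proof (cases rule: prelie_sequence_cases)
      case zero
      with b(3) null show ?thesis by simp
    next
      case (single k0 a)
      have "b l = a * (if l = k0 then 1 else 0)" for l using single by simp
      with b(3) single(1,2) have ?single unfolding weighted by metis
      then show ?thesis by blast
    next
      case (affine N \<alpha> \<beta>)
      have ?affine
        by (rule exI[of _ \<alpha>], rule exI[of _ \<beta>], rule exI[of _ N])
          (use affine b(3)[unfolded weighted] in \<open>simp add: fscale_0\<close>)
      then show ?thesis by blast
    qed
  next
    assume "?zero \<or> ?single \<or> ?affine"
    then have "\<exists>b. b 0 = 0 \<and> prelie_sequence b \<and> weighted_derivations b bullet"
    proof (elim disjE)
      assume ?zero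
      then show ?thesis using null by (intro exI[of _ "\<lambda>_. 0"]) (simp add: prelie_sequence_def)
    next
      assume ?single
      then obtain k0 and a :: 'k where "k0 \<noteq> 0" and X: "\<And>k l. bullet (X_pow k) (X_pow l) =
          fscale (a * (if l = k0 then 1 else 0) * of_int k) (X_pow k - X_pow (k + l))"
        by blast
      moreover have "weighted_derivations (\<lambda>l. if l = k0 then a else 0) bullet"
        unfolding weighted X by simp
      ultimately show ?thesis using prelie_sequence_single[of k0 a]
        by (intro exI[of _ "\<lambda>l. if l = k0 then a else 0"]) simp
    next
      assume ?affine
      then obtain \<alpha> \<beta> :: 'k and N :: nat where nz: "\<alpha> \<noteq> 0" "\<beta> \<noteq> 0" "N \<ge> 1"
        and denom: "\<And>n. n \<noteq> -1 \<Longrightarrow> of_int n * \<alpha> - of_int (n - 1) * \<beta> \<noteq> 0"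
        and X: "\<And>k l. bullet (X_pow k) (X_pow l) =
          (if l = 0 then 0
           else if int N dvd l then
             fscale (\<alpha> * \<beta> /
                 ((of_int l / of_nat N - 1) * \<alpha> - (of_int l / of_nat N - 2) * \<beta>) * of_int k)
               (X_pow k - X_pow (k + l))
           else 0)"
        by blast
      \<comment> \<open>the affine function with the values \<open>1 / \<alpha>\<close> at \<open>1\<close> and \<open>1 / \<beta>\<close> at \<open>2\<close>\<close>
      define A B where AB: "A = inverse \<beta> - inverse \<alpha>" "B = 2 * inverse \<alpha> - inverse \<beta>"
      have AB_eq: "of_int n * A + B = (of_int (n - 1) * \<alpha> - of_int (n - 2) * \<beta>) / (\<alpha> * \<beta>)" for n
        using nz by (simp add: AB field_simps)
      define b where "b l = (if l = 0 then 0 else if int N dvd l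
        then inverse (of_int (l div int N) * A + B) else 0)" for l
      have "of_int n * A + B \<noteq> 0" if "n \<noteq> 0" for n
        unfolding AB_eq using denom[of "n - 1"] that nz by simp
      then have "prelie_sequence b"
        unfolding b_def using nz(3) by (intro prelie_sequence_affine) simp_all
      moreover have "weighted_derivations b bullet"
        unfolding weighted
      proof (intro allI)
        fix k l
        show "bullet (X_pow k) (X_pow l) = fscale (b l * of_int k) (X_pow k - X_pow (k + l))"
        proof (cases "l \<noteq> 0 \<and> int N dvd l")
          case True
          then obtain n where n: "l = int N * n" by (auto elim: dvdE)
          have "of_int l / of_nat N = (of_int n :: 'k)" "l div int N = n"
            using nz(3) by (simp_all add: n)
          then show ?thesis using True nz by (simp add: X b_def AB_eq)
        qed (auto simp: X b_def fscale_0)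
      qed
      ultimately show ?thesis by (intro exI[of _ b]) (simp add: b_def)
    qed
    then show ?bialgebra using com_prelie_bialgebra_iff[OF assms(3)] by blast
  qed
qed

end
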